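(* Let $\mathbf{a},\mathbf{b}\in{\rm SL}(3,\mathbb{C})$. If ${\rm tr}(\mathbf{a}\mathbf{b}\mathbf{a}^{-1}\mathbf{b}^{-1})\ne{\rm tr}(\mathbf{b}\mathbf{a}\mathbf{b}^{-1}\mathbf{a}^{-1})$, then $\mathfrak{B}_\delta$ and $\mathfrak{B}_\theta$ are both bases of the $9$-dimensional complex vector space $\mathcal{M}$ of $3\times3$ complex matrices, where $$\mathfrak{B}_\delta=\big\{\delta(\mathbf{a}\mathbf{b}),\ \delta(\mathbf{a}\mathbf{b}^{-1}),\ \delta(\mathbf{a}^{-1}\mathbf{b}),\ \delta(\mathbf{a}^{-1}\mathbf{b}^{-1}),\ \delta(\mathbf{a}\mathbf{b}\mathbf{a}^{-1}),\ \delta(\mathbf{a}\mathbf{b}^{-1}\mathbf{a}^{-1}),\ \delta(\mathbf{b}\mathbf{a}\mathbf{b}^{-1}),\ \delta(\mathbf{b}\mathbf{a}^{-1}\mathbf{b}^{-1}),\ \delta(\mathbf{a}\mathbf{b}\mathbf{a}^{-1}\mathbf{b}^{-1})\big\},$$ $$\mathfrak{B}_\theta=\big\{\mathbf{e},\ \mathbf{a},\ \mathbf{a}^{-1},\ \mathbf{b},\ \mathbf{b}^{-1},\ \theta(\mathbf{a}\mathbf{b}),\ \theta(\mathbf{a}\mathbf{b}^{-1}),\ \theta(\mathbf{a}^{-1}\mathbf{b}),\ \theta(\mathbf{a}^{-1}\mathbf{b}^{-1})\big\}.$$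
   Context: $\mathbf{e}$ is the $3\times 3$ identity matrix. For a word $\mathbf{w}$ in $\mathbf{a}^{\pm1},\mathbf{b}^{\pm1}$, $\overleftarrow{\mathbf{w}}$ denotes the word written backwards (letters in reverse order, letters not inverted; e.g. the reverse of $\mathbf{a}\mathbf{b}\mathbf{a}^{-1}\mathbf{b}^{-1}$ is $\mathbf{b}^{-1}\mathbf{a}^{-1}\mathbf{b}\mathbf{a}$). Put $\theta(\mathbf{w})=\mathbf{w}+\overleftarrow{\mathbf{w}}$ and $\delta(\mathbf{w})=\mathbf{w}-\overleftarrow{\mathbf{w}}$, evaluated as matrices. *)

theory Defs
  imports "HOL-Analysis.Analysis"
begin

type_synonym cmat3 = "complex^3^3"

definition SL3 :: "cmat3 set" where
  "SL3 = {M. det M = 1}"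


(* HOL-Analysis only provides the real scaling of such matrices; "( *s )" at this type
   would scale by row vectors. *)
definition cscale :: "complex \<Rightarrow> cmat3 \<Rightarrow> cmat3" where
  "cscale c M = map_matrix ((*) c) M"

interpretation cmat: vector_space cscale
  by unfold_locales (simp_all add: cscale_def vec_eq_iff algebra_simps)

(* A basis is given as a list, so that independence is that of the listed family:
   "distinct" excludes repetitions, which "set" would hide. *)
definition is_basis :: "cmat3 list \<Rightarrow> bool" where
  "is_basis Ms \<longleftrightarrow>
     distinct Ms \<and> cmat.independent (set Ms) \<and> cmat.span (set Ms) = UNIV"


(* Words are kept formal and unreduced: reversal is an operation on words, not on the
   matrices they evaluate to. The suffix "i" stands for the inverse letter. *)
datatype letter = La | Lai | Lb | Lbi

type_synonym word = "letter list"

fun letter_mat :: "cmat3 \<Rightarrow> cmat3 \<Rightarrow> letter \<Rightarrow> cmat3" where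
  "letter_mat a b La = a"
| "letter_mat a b Lai = matrix_inv a"
| "letter_mat a b Lb = b"
| "letter_mat a b Lbi = matrix_inv b"

fun word_mat :: "cmat3 \<Rightarrow> cmat3 \<Rightarrow> word \<Rightarrow> cmat3" where
  "word_mat a b [] = mat 1"
| "word_mat a b (x # w) = letter_mat a b x ** word_mat a b w"

definition theta :: "cmat3 \<Rightarrow> cmat3 \<Rightarrow> word \<Rightarrow> cmat3" where
  "theta a b w = word_mat a b w + word_mat a b (rev w)"

definition delta :: "cmat3 \<Rightarrow> cmat3 \<Rightarrow> word \<Rightarrow> cmat3" where
  "delta a b w = word_mat a b w - word_mat a b (rev w)"

definition B_delta :: "cmat3 \<Rightarrow> cmat3 \<Rightarrow> cmat3 list" where
  "B_delta a b =
    [delta a b [La, Lb], delta a b [La, Lbi], delta a b [Lai, Lb], delta a b [Lai, Lbi],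
     delta a b [La, Lb, Lai], delta a b [La, Lbi, Lai],
     delta a b [Lb, La, Lbi], delta a b [Lb, Lai, Lbi],
     delta a b [La, Lb, Lai, Lbi]]"

definition B_theta :: "cmat3 \<Rightarrow> cmat3 \<Rightarrow> cmat3 list" where
  "B_theta a b =
    [mat 1, a, matrix_inv a, b, matrix_inv b,
     theta a b [La, Lb], theta a b [La, Lbi], theta a b [Lai, Lb], theta a b [Lai, Lbi]]"

end

theory Submission
  imports Defs
begin

text \<open>
  Under the trace form, the two families are dual to each other up to a triangular matrix: the
  \<open>i\<close>-th element of one and the \<open>j\<close>-th element of the other pair to \<open>0\<close> for \<open>i + j < 8\<close>, and to
  \<open>\<plusminus>(tr (aba\<^sup>-\<^sup>1b\<^sup>-\<^sup>1) - tr (bab\<^sup>-\<^sup>1a\<^sup>-\<^sup>1))\<close> for \<open>i + j = 8\<close> (counting from \<open>0\<close>). These pairings need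
  only cancellation of inverse letters and cyclic invariance of the trace. So both families are
  independent, and they have as many elements as the dimension.
\<close>

lemma trace_cscale: "trace (Y ** cscale c X) = c * trace (Y ** X)"
  by (simp add: trace_def matrix_matrix_mult_def cscale_def sum_distrib_left algebra_simps)

lemma trace_mul_eq_0_on_span:
  assumes "X \<in> cmat.span S" and "\<And>Z. Z \<in> S \<Longrightarrow> trace (Y ** Z) = 0"
  shows "trace (Y ** X) = 0"
  using assms(1)
proof (induction rule: cmat.span_induct_alt)
  case base
  show ?case by (simp add: trace_def matrix_matrix_mult_def)
next
  case (step c x y)
  then show ?case
    using assms(2) by (simp add: matrix_add_ldistrib trace_add trace_cscale)
qed

text \<open>The functional \<open>trace (Y ** _)\<close> of the last \<open>Y\<close> vanishes on
  all earlier elements, hence on their span, but not on the last \<open>X\<close>. So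
  \<open>X\<close> lies outside that span, and induction from the end of the lists applies.\<close>

lemma triangular_imp_independent:
  assumes "length Ys = length Xs"
    and "\<And>i j. j < i \<Longrightarrow> i < length Xs \<Longrightarrow> trace (Ys ! i ** Xs ! j) = 0"
    and "\<And>i. i < length Xs \<Longrightarrow> trace (Ys ! i ** Xs ! i) \<noteq> 0"
  shows "distinct Xs \<and> cmat.independent (set Xs)"
  using assms
proof (induction Ys Xs rule: rev_induct2)
  case 1
  show ?case by (simp add: cmat.independent_empty)
next
  case (4 Y Ys X Xs)
  have len: "length Ys = length Xs" using "4.prems"(1) by simp
  have IH: "distinct Xs \<and> cmat.independent (set Xs)"
  proof (rule "4.IH"[OF len])
    fix i j assume "j < i" "i < length Xs"
    then show "trace (Ys ! i ** Xs ! j) = 0"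
      using "4.prems"(2)[of j i] len by (simp add: nth_append)
  next
    fix i assume "i < length Xs"
    then show "trace (Ys ! i ** Xs ! i) \<noteq> 0"
      using "4.prems"(3)[of i] len by (simp add: nth_append)
  qed
  have 0: "trace (Y ** Z) = 0" if "Z \<in> set Xs" for Z
    using that "4.prems"(2)[of _ "length Xs"] len by (auto simp: in_set_conv_nth nth_append)
  have "trace (Y ** X) \<noteq> 0"
    using "4.prems"(3)[of "length Xs"] len by (simp add: nth_append)
  then have "X \<notin> cmat.span (set Xs)"
    using trace_mul_eq_0_on_span 0 by blast
  then show ?case
    using IH cmat.span_base by (auto simp: cmat.independent_insert)
qed auto

definition unit_mat :: "3 \<times> 3 \<Rightarrow> cmat3" where
  "unit_mat p = (\<chi> i j. if (i, j) = p then 1 else 0)"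

lemma span_unit_mat: "cmat.span (range unit_mat) = UNIV"
proof -
  have "X \<in> cmat.span (range unit_mat)" for X
  proof -
    have "X = (\<Sum>p\<in>UNIV. cscale (X $ fst p $ snd p) (unit_mat p))"
      by (simp add: vec_eq_iff cscale_def unit_mat_def if_distrib [of "(*) _"] cong: if_cong)
    also have "\<dots> \<in> cmat.span (range unit_mat)"
      by (intro cmat.span_sum cmat.span_scale cmat.span_base) simp
    finally show ?thesis .
  qed
  then show ?thesis by blast
qed

text \<open>A matrix outside the span would extend the family to ten independent elements, but the
  nine matrix units span the whole space.\<close>

lemma is_basis_if_independent:
  assumes "length Xs = 9" and "distinct Xs" and ind: "cmat.independent (set Xs)"
  shows "is_basis Xs"
proof -
  have bound: "card (insert X (set Xs)) \<le> 9" if "cmat.independent (insert X (set Xs))" for X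
  proof -
    have "card (insert X (set Xs)) \<le> card (range unit_mat)"
      using cmat.independent_span_bound[of "range unit_mat", OF _ that] span_unit_mat by simp
    also have "\<dots> \<le> card (UNIV :: (3 \<times> 3) set)"
      by (rule card_image_le) simp
    finally show ?thesis by simp
  qed
  have "X \<in> cmat.span (set Xs)" for X
  proof (rule ccontr)
    assume X: "X \<notin> cmat.span (set Xs)"
    then have "X \<notin> set Xs" and "cmat.independent (insert X (set Xs))"
      using ind cmat.span_base by (auto simp: cmat.independent_insert)
    then show False
      using bound[of X] assms by (simp add: distinct_card)
  qed
  then show ?thesis
    using assms by (auto simp: is_basis_def)
qed

lemma word_mat_append: "word_mat a b (u @ v) = word_mat a b u ** word_mat a b v"
  by (induction u) (simp_all add: matrix_mul_assoc)

text \<open>Hiding the matrices lets the simplifier compute with formal words only, by rotating and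
  cancelling letters.\<close>

definition word_trace :: "cmat3 \<Rightarrow> cmat3 \<Rightarrow> word \<Rightarrow> complex" where
  "word_trace a b w = trace (word_mat a b w)"

lemma word_trace_rotate: "word_trace a b (u @ v) = word_trace a b (v @ u)"
  unfolding word_trace_def word_mat_append by (rule trace_mul_sym)

lemma trace_word_mat_mult: "trace (word_mat a b u ** word_mat a b v) = word_trace a b (u @ v)"
  by (simp add: word_trace_def word_mat_append)

text \<open>Explicit lists, because a pattern \<open>u @ v\<close> does not match a concrete word.
  With all rotations of a given length present, ordered rewriting ends at the least one, a normal
  form for cyclic words. Length four suffices: for \<open>i + j \<le> 8\<close> no pairing involves
  a longer word.\<close>

lemmas word_trace_rotations =
  word_trace_rotate[of _ _ "[x]" "[y]", simplified]
  word_trace_rotate[of _ _ "[x]" "[y, z]", simplified]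
  word_trace_rotate[of _ _ "[x, y]" "[z]", simplified]
  word_trace_rotate[of _ _ "[x]" "[y, z, w]", simplified]
  word_trace_rotate[of _ _ "[x, y]" "[z, w]", simplified]
  word_trace_rotate[of _ _ "[x, y, z]" "[w]", simplified]
  for x y z w

fun inv_letter :: "letter \<Rightarrow> letter" where
  "inv_letter La = Lai"
| "inv_letter Lai = La"
| "inv_letter Lb = Lbi"
| "inv_letter Lbi = Lb"

lemma SL3_matrix_inv:
  assumes "M \<in> SL3"
  shows "M ** matrix_inv M = mat 1" and "matrix_inv M ** M = mat 1"
proof -
  have "invertible M"
    using assms by (simp add: SL3_def invertible_det_nz)
  then have "\<exists>N. M ** N = mat 1 \<and> N ** M = mat 1"
    by (simp add: invertible_def)
  from someI_ex[OF this] show "M ** matrix_inv M = mat 1" and "matrix_inv M ** M = mat 1"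
    by (simp_all add: matrix_inv_def)
qed

lemma letter_mat_inv:
  assumes "a \<in> SL3" and "b \<in> SL3"
  shows "letter_mat a b x ** letter_mat a b (inv_letter x) = mat 1"
  using assms by (cases x) (simp_all add: SL3_matrix_inv)

lemma word_trace_cancel:
  assumes "a \<in> SL3" and "b \<in> SL3" and "y = inv_letter x"
  shows "word_trace a b (u @ x # y # v) = word_trace a b (u @ v)"
proof -
  have "word_mat a b (x # y # v) = word_mat a b v"
    using letter_mat_inv[OF assms(1,2), of x] assms(3) by (simp add: matrix_mul_assoc)
  then show ?thesis
    by (simp only: word_trace_def word_mat_append)
qed

lemma word_trace_cyclic_cancel:
  assumes "a \<in> SL3" and "b \<in> SL3" and "y = inv_letter x"
  shows "word_trace a b (y # u @ [x]) = word_trace a b u"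
proof -
  have "word_trace a b (y # u @ [x]) = word_trace a b (u @ [x, y])"
    using word_trace_rotate[of a b "[y]" "u @ [x]"] by simp
  also have "\<dots> = word_trace a b u"
    using word_trace_cancel[OF assms, of u "[]"] by (simp only: append_Nil2)
  finally show ?thesis .
qed

text \<open>These are the places where inverse letters can be adjacent in a cyclic word of at most
  four letters: the first three rules treat neighbours in the list, the last two its two
  ends.\<close>

lemma word_trace_cancellations:
  assumes "a \<in> SL3" and "b \<in> SL3" and "y = inv_letter x"
  shows "word_trace a b (x # y # v) = word_trace a b v"
    and "word_trace a b (z # x # y # v) = word_trace a b (z # v)"
    and "word_trace a b (z # w # x # y # v) = word_trace a b (z # w # v)"
    and "word_trace a b [y, z, x] = word_trace a b [z]"
    and "word_trace a b [y, z, w, x] = word_trace a b [z, w]"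
  using word_trace_cancel[OF assms, of "[]" v] word_trace_cancel[OF assms, of "[z]" v]
    word_trace_cancel[OF assms, of "[z, w]" v] word_trace_cyclic_cancel[OF assms, of "[z]"]
    word_trace_cyclic_cancel[OF assms, of "[z, w]"]
  by (simp_all only: append.simps)

text \<open>With the first five entries written as words too, every pairing expands into values of
  \<open>word_trace\<close>.\<close>

lemma B_theta_word_mat:
  "B_theta a b =
    [word_mat a b [], word_mat a b [La], word_mat a b [Lai], word_mat a b [Lb], word_mat a b [Lbi],
     theta a b [La, Lb], theta a b [La, Lbi], theta a b [Lai, Lb], theta a b [Lai, Lbi]]"
  by (simp add: B_theta_def)

lemma trace_theta_mult:
  "trace (theta a b u ** X) = trace (word_mat a b u ** X) + trace (word_mat a b (rev u) ** X)"
  by (simp only: theta_def trace_mul_sym[of _ X] matrix_add_ldistrib trace_add)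

lemma trace_mult_delta:
  "trace (X ** delta a b u) = trace (X ** word_mat a b u) - trace (X ** word_mat a b (rev u))"
proof -
  have "X ** word_mat a b u = X ** delta a b u + X ** word_mat a b (rev u)"
    by (simp add: delta_def flip: matrix_add_ldistrib)
  then show ?thesis
    by (simp add: trace_add)
qed

text \<open>The second word in \<open>D\<close> is a rotation of the reverse of the first, so
  reversal changes the sign of \<open>D\<close>. For instance, \<theta>(ab) against \<delta>(a'b'),
  with a' and b' the inverses, gives tr(aba'b') - tr(e) + tr(e) - tr(bab'a') =
  \<open>D\<close>.\<close>

lemma trace_B_theta_B_delta:
  assumes "a \<in> SL3" and "b \<in> SL3"
  defines "D \<equiv> word_trace a b [La, Lb, Lai, Lbi] - word_trace a b [Lb, La, Lbi, Lai]"
  shows "\<forall>i<9. \<forall>j<9.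
     (i + j < 8 \<longrightarrow> trace (B_theta a b ! i ** B_delta a b ! j) = 0) \<and>
     (i + j = 8 \<longrightarrow> trace (B_theta a b ! i ** B_delta a b ! j) \<in> {D, - D})"
  unfolding B_theta_word_mat B_delta_def D_def
  \<comment> \<open>The bounded quantifiers become single cases; \<open>word_mat.simps\<close> is
    removed because it would dissolve the words into matrix products.\<close>
  by (simp add: numeral_eq_Suc All_less_Suc trace_theta_mult trace_mult_delta trace_word_mat_mult
    word_trace_cancellations[OF assms(1,2)] word_trace_rotations del: word_mat.simps)

theorem theorem3p6:
  fixes a b :: "complex^3^3"
  assumes "a \<in> SL3" and "b \<in> SL3"
    and "trace (a ** b ** matrix_inv a ** matrix_inv b)
         \<noteq> trace (b ** a ** matrix_inv b ** matrix_inv a)"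
  shows "is_basis (B_delta a b) \<and> is_basis (B_theta a b)"
proof -
  let ?D = "word_trace a b [La, Lb, Lai, Lbi] - word_trace a b [Lb, La, Lbi, Lai]"
  have "?D \<noteq> 0"
    using assms(3) by (simp add: word_trace_def matrix_mul_assoc)
  then have nonzero: "trace (B_theta a b ! i ** B_delta a b ! j) \<noteq> 0" if "i + j = 8" for i j
    using trace_B_theta_B_delta[OF assms(1,2), rule_format, of i j] that by auto
  have zero: "trace (B_theta a b ! i ** B_delta a b ! j) = 0" if "i + j < 8" for i j
    using trace_B_theta_B_delta[OF assms(1,2), rule_format, of i j] that by simp
  have len: "length (B_theta a b) = 9" "length (B_delta a b) = 9"
    by (simp_all add: B_theta_def B_delta_def)
  have "is_basis (B_delta a b)"
    \<comment> \<open>Reversing one list moves the antidiagonal i + j = 8 to the diagonal: entry i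
      of the reversed list is entry 8 - i, and 8 - i + j < 8 exactly when j < i.\<close>
    using triangular_imp_independent[of "rev (B_theta a b)" "B_delta a b"] zero nonzero
    by (intro is_basis_if_independent) (simp_all add: len rev_nth)
  moreover have "is_basis (B_theta a b)"
    \<comment> \<open>The conditions on i + j and the trace form are symmetric, so the two families
      can exchange roles.\<close>
    using triangular_imp_independent[of "rev (B_delta a b)" "B_theta a b"] zero nonzero
    by (intro is_basis_if_independent)
      (simp_all add: len rev_nth trace_mul_sym[of "B_delta a b ! _"])
  ultimately show ?thesis ..
qed

end
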